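(* Let $k\ge 3$ and $0\le\alpha<1$. Let $G$ be a connected $k$-uniform hypergraph on $n$ vertices with $m$ edges, and let $S$ be a nonempty subset of $V(G)$ with $|S|=s$. Then $$\rho_{\alpha}(G)-\frac{km}{n}\ \ge\ \frac{1}{kn}\left(\alpha\sum_{i\in S}d_{i}\left(\left(\frac{s\,d_{i}^{\frac{k}{k-1}}}{\sum_{j\in S}d_{j}^{\frac{k}{k-1}}}\right)^{\frac12}-1\right)^{2}+k\left(s^{\frac1k}\left(\sum_{i\in S}d_{i}^{\frac{k}{k-1}}\right)^{\frac{k-1}{k}}-\sum_{i\in S}d_{i}\right)\right).$$
   Context: A $k$-uniform hypergraph $G=(V(G),E(G))$ has a finite vertex set $V(G)$ (identified with $[n]=\{1,\dots,n\}$) and an edge set $E(G)$ consisting of distinct $k$-element subsets of $V(G)$; hypergraphs are assumed to have at least one edge. The degree $d_i$ of a vertex $i$ is the number of edges containing $i$. $G$ is connected if every two vertices $u,v$ are joined by a sequence $u=v_1,e_1,v_2,\dots,e_\ell,v_{\ell+1}=v$ with $e_t\in E(G)$ and $\{v_t,v_{t+1}\}\subseteq e_t$. The adjacency tensor $\mathcal{A}(G)$ is the tensor of order $k$ and dimension $n$ with entries $a_{i_1\ldots i_k}=\frac{1}{(k-1)!}$ if $\{i_1,\dots,i_k\}\in E(G)$ and $0$ otherwise; $\mathcal{D}(G)$ is the diagonal tensor of order $k$ and dimension $n$ with diagonal entries $d_{i\ldots i}=d_i$ and all other entries $0$. For $0\le\alpha<1$, $\mathcal{A}_\alpha(G)=\alpha\mathcal{D}(G)+(1-\alpha)\mathcal{A}(G)$.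 For a tensor $\mathcal{T}=(t_{i_1\ldots i_k})$ of order $k$ and dimension $n$ and $x\in\mathbb{C}^n$, $(\mathcal{T}x)_i=\sum_{i_2,\dots,i_k=1}^n t_{ii_2\ldots i_k}x_{i_2}\cdots x_{i_k}$. A number $\lambda\in\mathbb{C}$ is an eigenvalue of $\mathcal{T}$ with eigenvector $0\ne x\in\mathbb{C}^n$ if $(\mathcal{T}x)_i=\lambda x_i^{k-1}$ for all $i$; the spectral radius $\rho(\mathcal{T})$ is the maximum of $|\lambda|$ over eigenvalues $\lambda$ of $\mathcal{T}$. $\rho_\alpha(G)=\rho(\mathcal{A}_\alpha(G))$. *)

theory Defs
  imports Complex_Main
begin

section \<open>Uniform hypergraphs on the vertex set \<open>{1..n}\<close>\<close>

definition uniform_hypergraph :: "nat \<Rightarrow> nat \<Rightarrow> nat set set \<Rightarrow> bool" where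
  "uniform_hypergraph k n E \<longleftrightarrow> E \<noteq> {} \<and> (\<forall>e\<in>E. e \<subseteq> {1..n} \<and> card e = k)"

definition vertex_degree :: "nat set set \<Rightarrow> nat \<Rightarrow> nat" where
  "vertex_degree E i = card {e \<in> E. i \<in> e}"

definition hypergraph_walk :: "nat set set \<Rightarrow> nat \<Rightarrow> nat list \<Rightarrow> nat set list \<Rightarrow> nat \<Rightarrow> bool" where
  "hypergraph_walk E u vs es v \<longleftrightarrow>
     length vs = length es + 1 \<and> hd vs = u \<and> last vs = v \<and> set es \<subseteq> E \<and>
     (\<forall>t<length es. {vs ! t, vs ! (t + 1)} \<subseteq> es ! t)"

definition connected_hypergraph :: "nat \<Rightarrow> nat set set \<Rightarrow> bool" where
  "connected_hypergraph n E \<longleftrightarrow> (\<forall>u\<in>{1..n}. \<forall>v\<in>{1..n}. \<exists>vs es. hypergraph_walk E u vs es v)"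

section \<open>Tensors\<close>

text \<open>
  A tensor of order \<open>k\<close> and dimension \<open>n\<close> maps an index tuple, encoded as a list of length \<open>k\<close>
  over \<open>{1..n}\<close>, to its entry; values at all other lists are irrelevant. Likewise a vector is
  a function of which only the values on \<open>{1..n}\<close> matter.
\<close>

type_synonym tensor = "nat list \<Rightarrow> complex"

definition tensor_apply :: "nat \<Rightarrow> nat \<Rightarrow> tensor \<Rightarrow> (nat \<Rightarrow> complex) \<Rightarrow> nat \<Rightarrow> complex" where
  "tensor_apply k n T x i =
     (\<Sum>js | length js = k - 1 \<and> set js \<subseteq> {1..n}. T (i # js) * prod_list (map x js))"

definition tensor_eigenvector ::
    "nat \<Rightarrow> nat \<Rightarrow> tensor \<Rightarrow> complex \<Rightarrow> (nat \<Rightarrow> complex) \<Rightarrow> bool" where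
  "tensor_eigenvector k n T c x \<longleftrightarrow>
     (\<exists>i\<in>{1..n}. x i \<noteq> 0) \<and> (\<forall>i\<in>{1..n}. tensor_apply k n T x i = c * x i ^ (k - 1))"

definition tensor_eigenvalue :: "nat \<Rightarrow> nat \<Rightarrow> tensor \<Rightarrow> complex \<Rightarrow> bool" where
  "tensor_eigenvalue k n T c \<longleftrightarrow> (\<exists>x. tensor_eigenvector k n T c x)"

text \<open>
  For \<open>k \<ge> 2\<close> and \<open>n \<ge> 1\<close> the set of moduli below is nonempty and compact, so its supremum is its
  maximum. \<open>Max\<close> would yield this value only once the set is known to be finite.
\<close>

definition tensor_spectral_radius :: "nat \<Rightarrow> nat \<Rightarrow> tensor \<Rightarrow> real" where
  "tensor_spectral_radius k n T = Sup {cmod c | c. tensor_eigenvalue k n T c}"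

section \<open>The tensors of a hypergraph\<close>

definition adjacency_tensor :: "nat \<Rightarrow> nat set set \<Rightarrow> tensor" where
  "adjacency_tensor k E js = (if set js \<in> E then 1 / fact (k - 1) else 0)"

definition degree_tensor :: "nat \<Rightarrow> nat set set \<Rightarrow> tensor" where
  "degree_tensor k E js = (if js = replicate k (hd js) then of_nat (vertex_degree E (hd js)) else 0)"

definition A_alpha_tensor :: "real \<Rightarrow> nat \<Rightarrow> nat set set \<Rightarrow> tensor" where
  "A_alpha_tensor \<alpha> k E js =
     complex_of_real \<alpha> * degree_tensor k E js
       + complex_of_real (1 - \<alpha>) * adjacency_tensor k E js"

definition rho_alpha :: "real \<Rightarrow> nat \<Rightarrow> nat \<Rightarrow> nat set set \<Rightarrow> real" where
  "rho_alpha \<alpha> k n E = tensor_spectral_radius k n (A_alpha_tensor \<alpha> k E)"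

end

(* A positive eigenvector u of A_alpha with eigenvalue c <= rho_alpha is found by maximising the
   homogeneous form of A_alpha over the nonnegative part of the k-norm sphere: connectedness forces
   every maximiser to be positive, since raising the zero entries to eps gains at least order
   eps^(k-1) along an edge crossing the support but costs only order eps^k in the norm.

   Let x be 1 off S, with x_i^k proportional to d_i^(k/(k-1)) on S and sum of x_i^k equal to n.
   Multiplying the i-th eigenvalue equation by x_i^k + k - 1, summing over i, and using on every edge
   the AM-GM inequality for the k numbers x_i^k / u_i^k and 1 / u_j^k (j distinct from i) yields
   k n c >= alpha sum_i d_i (x_i^k + k - 1 - k x_i) + k sum_i d_i x_i. Since the first bracket is at
   least (x_i^(k/2) - 1)^2, and x is the Hoelder extremal of sum d_i x_i on S, this is the claim. *)
theory Submission
  imports Defs "HOL-Analysis.Analysis" "HOL-Combinatorics.Multiset_Permutations"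
begin

section \<open>Boundedness of the eigenvalues of a tensor\<close>

lemma norm_prod_list_le:
  fixes x :: "'a \<Rightarrow> complex"
  assumes "\<And>j. j \<in> set js \<Longrightarrow> cmod (x j) \<le> M"
  shows "cmod (prod_list (map x js)) \<le> M ^ length js"
  using assms
proof (induction js)
  case Nil
  then show ?case by simp
next
  case (Cons a js)
  have "cmod (x a) \<le> M" "cmod (prod_list (map x js)) \<le> M ^ length js"
    using Cons by auto
  then show ?case
    by (auto simp: norm_mult intro!: mult_mono order_trans[OF norm_ge_zero, of "x a" M])
qed

lemma finite_index_lists: "finite {js :: nat list. length js = l \<and> set js \<subseteq> {1..n}}"
  using finite_lists_length_eq[of "{1..n}" l] by (simp add: conj_commute)

text \<open>The eigenvalue equation at a coordinate of largest modulus bounds \<open>cmod c\<close>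
  by the absolute sum of that row; adding up all rows makes the bound independent of the
  eigenvector. It bounds the set of moduli above, without which the \<open>Sup\<close> in the
  spectral radius would say nothing.\<close>

lemma cmod_tensor_eigenvalue_le:
  assumes "tensor_eigenvalue k n T c"
  shows "cmod c \<le> (\<Sum>i\<in>{1..n}. \<Sum>js | length js = k - 1 \<and> set js \<subseteq> {1..n}. cmod (T (i # js)))"
proof -
  let ?L = "{js :: nat list. length js = k - 1 \<and> set js \<subseteq> {1..n}}"
  obtain x where x: "\<exists>i\<in>{1..n}. x i \<noteq> 0"
    and eq: "\<And>i. i \<in> {1..n} \<Longrightarrow> tensor_apply k n T x i = c * x i ^ (k - 1)"
    using assms unfolding tensor_eigenvalue_def tensor_eigenvector_def by blast
  define M where "M = Max ((\<lambda>i. cmod (x i)) ` {1..n})"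
  have M_ge: "cmod (x j) \<le> M" if "j \<in> {1..n}" for j
    unfolding M_def using that by (intro Max_ge) auto
  have "M \<in> (\<lambda>i. cmod (x i)) ` {1..n}"
    unfolding M_def using x by (intro Max_in) auto
  then obtain i where i: "i \<in> {1..n}" "cmod (x i) = M" by auto
  have M_pos: "M > 0"
    using x M_ge by (metis less_le_trans zero_less_norm_iff)
  have "cmod c * M ^ (k - 1) = cmod (tensor_apply k n T x i)"
    using eq[OF i(1)] i(2) by (simp add: norm_mult norm_power)
  also have "\<dots> \<le> (\<Sum>js\<in>?L. cmod (T (i # js)) * M ^ (k - 1))"
    unfolding tensor_apply_def
  proof (rule sum_norm_le)
    fix js assume js: "js \<in> ?L"
    then have "cmod (prod_list (map x js)) \<le> M ^ length js"
      by (intro norm_prod_list_le M_ge) auto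
    then show "cmod (T (i # js) * prod_list (map x js)) \<le> cmod (T (i # js)) * M ^ (k - 1)"
      using js by (simp add: norm_mult mult_left_mono)
  qed
  also have "\<dots> = (\<Sum>js\<in>?L. cmod (T (i # js))) * M ^ (k - 1)"
    by (simp add: sum_distrib_right)
  finally have "cmod c \<le> (\<Sum>js\<in>?L. cmod (T (i # js)))"
    using M_pos by simp
  also have "\<dots> \<le> (\<Sum>i\<in>{1..n}. \<Sum>js\<in>?L. cmod (T (i # js)))"
    by (rule member_le_sum[OF i(1)]) (auto intro: sum_nonneg)
  finally show ?thesis .
qed

lemma cmod_eigenvalue_le_spectral_radius:
  assumes "tensor_eigenvalue k n T c"
  shows "cmod c \<le> tensor_spectral_radius k n T"
  unfolding tensor_spectral_radius_def
  using assms
  by (intro cSup_upper) (auto simp: bdd_above_def intro: cmod_tensor_eigenvalue_le)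

section \<open>Double counting of incidences between vertices and edges\<close>

lemma uniform_hypergraphD:
  assumes "uniform_hypergraph k n E"
  shows "E \<noteq> {}" and "finite E"
    and "\<And>e. e \<in> E \<Longrightarrow> e \<subseteq> {1..n}" and "\<And>e. e \<in> E \<Longrightarrow> card e = k"
    and "\<And>e. e \<in> E \<Longrightarrow> finite e"
proof -
  show "E \<noteq> {}" and 1: "\<And>e. e \<in> E \<Longrightarrow> e \<subseteq> {1..n}" and "\<And>e. e \<in> E \<Longrightarrow> card e = k"
    using assms unfolding uniform_hypergraph_def by auto
  have "E \<subseteq> Pow {1..n}" using 1 by blast
  then show "finite E" by (rule finite_subset) simp
  show "\<And>e. e \<in> E \<Longrightarrow> finite e" using 1 by (meson finite_atLeastAtMost finite_subset)
qed

lemma sum_edges_swap: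
  fixes g :: "nat set \<Rightarrow> nat \<Rightarrow> real"
  assumes "uniform_hypergraph k n E"
  shows "(\<Sum>e\<in>E. \<Sum>i\<in>e. g e i) = (\<Sum>i\<in>{1..n}. \<Sum>e | e \<in> E \<and> i \<in> e. g e i)"
proof -
  note E = uniform_hypergraphD[OF assms]
  have "(\<Sum>i\<in>{1..n}. \<Sum>e | e \<in> E \<and> i \<in> e. g e i) = (\<Sum>e\<in>E. \<Sum>i | i \<in> {1..n} \<and> i \<in> e. g e i)"
    using E(2) by (intro sum.swap_restrict) auto
  also have "\<dots> = (\<Sum>e\<in>E. \<Sum>i\<in>e. g e i)"
  proof (rule sum.cong[OF refl])
    fix e assume "e \<in> E"
    then have "{i. i \<in> {1..n} \<and> i \<in> e} = e" using E(3) by blast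
    then show "(\<Sum>i | i \<in> {1..n} \<and> i \<in> e. g e i) = (\<Sum>i\<in>e. g e i)" by simp
  qed
  finally show ?thesis ..
qed

lemma sum_edges_vertex:
  fixes f :: "nat \<Rightarrow> real"
  assumes "uniform_hypergraph k n E"
  shows "(\<Sum>e\<in>E. \<Sum>i\<in>e. f i) = (\<Sum>i\<in>{1..n}. real (vertex_degree E i) * f i)"
  unfolding sum_edges_swap[OF assms] by (simp add: vertex_degree_def)

lemma sum_vertex_degree:
  assumes "uniform_hypergraph k n E"
  shows "(\<Sum>i\<in>{1..n}. real (vertex_degree E i)) = real k * real (card E)"
  using sum_edges_vertex[OF assms, of "\<lambda>_. 1"] uniform_hypergraphD(4)[OF assms]
  by (simp add: mult.commute)

section \<open>Action of the tensors of a hypergraph on a vector\<close>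

text \<open>An edge \<open>e\<close> through \<open>i\<close> is met by exactly the (k-1)! orderings
  of \<open>e - {i}\<close>, which cancels the factor \<open>1 / fact (k - 1)\<close>. Index lists
  with a repetition have fewer than \<open>k\<close> distinct entries and never form an
  edge.\<close>

lemma tensor_apply_adjacency:
  assumes E: "uniform_hypergraph k n E" and k: "k \<ge> 1"
  shows "tensor_apply k n (adjacency_tensor k E) x i = (\<Sum>e | e \<in> E \<and> i \<in> e. \<Prod>j\<in>e - {i}. x j)"
proof -
  note ED = uniform_hypergraphD[OF E]
  let ?L = "{js. length js = k - 1 \<and> set js \<subseteq> {1..n}}"
  let ?P = "\<lambda>e. permutations_of_set (e - {i})"
  have L: "finite ?L" by (rule finite_index_lists)
  have perm: "js \<in> ?P e \<longleftrightarrow> js \<in> ?L \<and> set (i # js) = e" if e: "e \<in> E" "i \<in> e" for js e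
  proof
    assume "js \<in> ?P e"
    then have js: "set js = e - {i}" "distinct js" by (auto simp: permutations_of_set_def)
    then have "length js = card (e - {i})" using distinct_card by metis
    then show "js \<in> ?L \<and> set (i # js) = e"
      using e ED(3)[of e] ED(4)[of e] ED(5)[of e] js by auto
  next
    assume js: "js \<in> ?L \<and> set (i # js) = e"
    then have "card (set (i # js)) = length (i # js)" using ED(4)[OF e(1)] k by simp
    then have "distinct (i # js)" by (rule card_distinct)
    then show "js \<in> ?P e" using js by (auto simp: permutations_of_set_def)
  qed
  \<comment> \<open>The test for being an edge becomes a sum over at most one edge, so that the
    summations over lists and edges can be exchanged.\<close>
  have "tensor_apply k n (adjacency_tensor k E) x i =
      (\<Sum>js\<in>?L. \<Sum>e | e \<in> E \<and> (i \<in> e \<and> set (i # js) = e). 1 / fact (k - 1) * prod_list (map x js))"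
    unfolding tensor_apply_def
  proof (rule sum.cong[OF refl])
    fix js assume "js \<in> ?L"
    have *: "{e. e \<in> E \<and> (i \<in> e \<and> set (i # js) = e)} = (if set (i # js) \<in> E then {set (i # js)} else {})"
      by auto
    show "adjacency_tensor k E (i # js) * prod_list (map x js) =
      (\<Sum>e | e \<in> E \<and> (i \<in> e \<and> set (i # js) = e). 1 / fact (k - 1) * prod_list (map x js))"
      unfolding * adjacency_tensor_def by simp
  qed
  also have "\<dots> = (\<Sum>e\<in>E. \<Sum>js | js \<in> ?L \<and> (i \<in> e \<and> set (i # js) = e). 1 / fact (k - 1) * prod_list (map x js))"
    using L ED(2) by (rule sum.swap_restrict)
  also have "\<dots> = (\<Sum>e\<in>E. if i \<in> e then \<Prod>j\<in>e - {i}. x j else 0)"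
  proof (rule sum.cong[OF refl])
    fix e assume e: "e \<in> E"
    show "(\<Sum>js | js \<in> ?L \<and> (i \<in> e \<and> set (i # js) = e). 1 / fact (k - 1) * prod_list (map x js))
      = (if i \<in> e then \<Prod>j\<in>e - {i}. x j else 0)"
    proof (cases "i \<in> e")
      case True
      have "{js. js \<in> ?L \<and> (i \<in> e \<and> set (i # js) = e)} = ?P e"
      proof (rule set_eqI)
        show "js \<in> {js. js \<in> ?L \<and> (i \<in> e \<and> set (i # js) = e)} \<longleftrightarrow> js \<in> ?P e" for js
          unfolding perm[OF e True] mem_Collect_eq by (simp only: True simp_thms)
      qed
      moreover have "prod_list (map x js) = (\<Prod>j\<in>e - {i}. x j)" if "js \<in> ?P e" for js
        using prod.distinct_set_conv_list[of js x] permutations_of_setD[OF that] by simp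
      moreover have "card (?P e) = fact (k - 1)"
        using ED(4)[OF e] ED(5)[OF e] True by simp
      ultimately show ?thesis using True by (simp only:) simp
    qed simp
  qed
  also have "\<dots> = (\<Sum>e | e \<in> E \<and> i \<in> e. \<Prod>j\<in>e - {i}. x j)"
    using ED(2) by (simp add: sum.inter_filter)
  finally show ?thesis .
qed

lemma tensor_apply_degree:
  assumes k: "k \<ge> 1" and i: "i \<in> {1..n}"
  shows "tensor_apply k n (degree_tensor k E) x i = of_nat (vertex_degree E i) * x i ^ (k - 1)"
proof -
  let ?L = "{js. length js = k - 1 \<and> set js \<subseteq> {1..n}}"
  have rep: "i # js = replicate k i \<longleftrightarrow> js = replicate (k - 1) i" for js
    using k by (cases k) auto
  have "tensor_apply k n (degree_tensor k E) x i =
      (\<Sum>js\<in>?L. if js = replicate (k - 1) i then of_nat (vertex_degree E i) * prod_list (map x js) else 0)"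
    unfolding tensor_apply_def degree_tensor_def by (intro sum.cong refl) (simp add: rep)
  also have "\<dots> = of_nat (vertex_degree E i) * x i ^ (k - 1)"
    using i finite_index_lists[of "k - 1" n] by (subst sum.delta) (auto simp: prod_list_replicate)
  finally show ?thesis .
qed

lemma tensor_apply_A_alpha:
  assumes "uniform_hypergraph k n E" "k \<ge> 1" "i \<in> {1..n}"
  shows "tensor_apply k n (A_alpha_tensor \<alpha> k E) x i =
    of_real \<alpha> * of_nat (vertex_degree E i) * x i ^ (k - 1)
      + of_real (1 - \<alpha>) * (\<Sum>e | e \<in> E \<and> i \<in> e. \<Prod>j\<in>e - {i}. x j)"
proof -
  have "tensor_apply k n (A_alpha_tensor \<alpha> k E) x i =
      of_real \<alpha> * tensor_apply k n (degree_tensor k E) x i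
      + of_real (1 - \<alpha>) * tensor_apply k n (adjacency_tensor k E) x i"
    unfolding tensor_apply_def A_alpha_tensor_def
    by (simp add: algebra_simps sum.distrib sum_subtractf sum_distrib_left)
  then show ?thesis
    using tensor_apply_adjacency[OF assms(1,2)] tensor_apply_degree[OF assms(2,3)]
    by (simp add: mult.assoc)
qed

text \<open>A real solution of the eigenvalue equations is also a complex eigenvector, and
  \<open>c\<close> is at most its modulus.\<close>

lemma le_rho_alphaI:
  fixes u :: "nat \<Rightarrow> real"
  assumes E: "uniform_hypergraph k n E" and "k \<ge> 1" and u: "j \<in> {1..n}" "u j \<noteq> 0"
    and eq: "\<And>i. i \<in> {1..n} \<Longrightarrow> \<alpha> * real (vertex_degree E i) * u i ^ (k - 1)
      + (1 - \<alpha>) * (\<Sum>e | e \<in> E \<and> i \<in> e. \<Prod>j\<in>e - {i}. u j) = c * u i ^ (k - 1)"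
  shows "c \<le> rho_alpha \<alpha> k n E"
proof -
  have "tensor_eigenvector k n (A_alpha_tensor \<alpha> k E) (of_real c) (\<lambda>i. of_real (u i))"
    unfolding tensor_eigenvector_def
  proof (intro conjI ballI)
    show "\<exists>i\<in>{1..n}. complex_of_real (u i) \<noteq> 0" using u by auto
    fix i assume i: "i \<in> {1..n}"
    show "tensor_apply k n (A_alpha_tensor \<alpha> k E) (\<lambda>i. of_real (u i)) i
        = of_real c * of_real (u i) ^ (k - 1)"
      unfolding tensor_apply_A_alpha[OF E \<open>k \<ge> 1\<close> i]
      using arg_cong[OF eq[OF i], of complex_of_real] by simp
  qed
  then have "cmod (of_real c) \<le> rho_alpha \<alpha> k n E"
    unfolding rho_alpha_def tensor_eigenvalue_def[abs_def]
    by (intro cmod_eigenvalue_le_spectral_radius) (auto simp: tensor_eigenvalue_def)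
  then show ?thesis by simp
qed

section \<open>Edges crossing a vertex set\<close>

text \<open>A walk that starts in \<open>Z\<close> and ends outside it has a first step leaving
  \<open>Z\<close>, and the edge of that step contains both of its ends.\<close>

lemma connected_hypergraph_crossing_edge:
  assumes "connected_hypergraph n E" and "u \<in> {1..n}" "u \<in> Z" and "v \<in> {1..n}" "v \<notin> Z"
  obtains e a b where "e \<in> E" "a \<in> e" "a \<in> Z" "b \<in> e" "b \<notin> Z"
proof -
  obtain vs es where w: "hypergraph_walk E u vs es v"
    using assms unfolding connected_hypergraph_def by blast
  then have len: "length vs = length es + 1" and hd: "hd vs = u" and last: "last vs = v"
    and es: "set es \<subseteq> E" and st: "\<And>t. t < length es \<Longrightarrow> {vs ! t, vs ! (t + 1)} \<subseteq> es ! t"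
    unfolding hypergraph_walk_def by auto
  have ne: "vs \<noteq> []" using len by auto
  have "\<exists>t<length es. vs ! t \<in> Z \<and> vs ! (t + 1) \<notin> Z"
  proof (rule ccontr)
    assume *: "\<not> ?thesis"
    have "t \<le> length es \<Longrightarrow> vs ! t \<in> Z" for t
    proof (induction t)
      case 0
      then show ?case using hd ne assms(3) by (simp add: hd_conv_nth)
    next
      case (Suc t)
      then show ?case using * by auto
    qed
    from this[of "length es"] show False
      using last len ne assms(5) by (simp add: last_conv_nth)
  qed
  then obtain t where t: "t < length es" "vs ! t \<in> Z" "vs ! (t + 1) \<notin> Z" by blast
  show thesis
    using that[of "es ! t" "vs ! t" "vs ! (t + 1)"] t st[OF t(1)] subsetD[OF es nth_mem[OF t(1)]] by auto
qed

section \<open>The homogeneous form and its positive maximiser\<close>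

text \<open>This is the sum over \<open>i\<close> of \<open>x i\<close> times the
  \<open>i\<close>-th entry of the tensor applied to \<open>x\<close>. The factor
  \<open>real k\<close> appears because each edge is counted once for each of its vertices.\<close>

definition alpha_form :: "real \<Rightarrow> nat \<Rightarrow> nat \<Rightarrow> nat set set \<Rightarrow> (nat \<Rightarrow> real) \<Rightarrow> real" where
  "alpha_form \<alpha> k n E x = \<alpha> * (\<Sum>i\<in>{1..n}. real (vertex_degree E i) * x i ^ k)
     + (1 - \<alpha>) * real k * (\<Sum>e\<in>E. \<Prod>i\<in>e. x i)"

lemma alpha_form_scale:
  assumes "uniform_hypergraph k n E"
  shows "alpha_form \<alpha> k n E (\<lambda>i. c * x i) = c ^ k * alpha_form \<alpha> k n E x"
proof -
  have "(\<Sum>e\<in>E. \<Prod>i\<in>e. c * x i) = c ^ k * (\<Sum>e\<in>E. \<Prod>i\<in>e. x i)"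
    unfolding sum_distrib_left
    by (intro sum.cong refl) (simp add: prod.distrib uniform_hypergraphD[OF assms])
  moreover have "(\<Sum>i\<in>{1..n}. real (vertex_degree E i) * (c * x i) ^ k)
      = c ^ k * (\<Sum>i\<in>{1..n}. real (vertex_degree E i) * x i ^ k)"
    unfolding sum_distrib_left by (intro sum.cong refl) (simp add: power_mult_distrib)
  ultimately show ?thesis unfolding alpha_form_def by (simp add: algebra_simps)
qed

lemma alpha_form_cong:
  assumes "uniform_hypergraph k n E" "\<And>i. i \<in> {1..n} \<Longrightarrow> x i = y i"
  shows "alpha_form \<alpha> k n E x = alpha_form \<alpha> k n E y"
proof -
  have "(\<Prod>i\<in>e. x i) = (\<Prod>i\<in>e. y i)" if "e \<in> E" for e
    using uniform_hypergraphD(3)[OF assms(1) that] assms(2) by (intro prod.cong) auto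
  then show ?thesis unfolding alpha_form_def using assms(2) by simp
qed

text \<open>Vectors are functions on all of \<open>nat\<close>. Pinning the entries outside
  \<open>A\<close> to 0 places the set inside a product of compact intervals, which is compact by
  Tychonoff's theorem.\<close>

lemma compact_nonneg_power_sphere:
  fixes A :: "nat set"
  assumes "finite A" "k \<ge> 1"
  shows "compact {x :: nat \<Rightarrow> real. (\<forall>i\<in>A. 0 \<le> x i) \<and> (\<forall>i. i \<notin> A \<longrightarrow> x i = 0) \<and> (\<Sum>i\<in>A. x i ^ k) = 1}"
    (is "compact ?K")
proof -
  let ?B = "PiE UNIV (\<lambda>i. if i \<in> A then {0..1} else {0 :: real})"
  let ?H = "{x :: nat \<Rightarrow> real. (\<Sum>i\<in>A. x i ^ k) = 1}"
  have "compactin (product_topology (\<lambda>i :: nat. euclidean :: real topology) UNIV) ?B"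
    by (subst compactin_PiE) auto
  then have B: "compact ?B" by (simp add: euclidean_product_topology)
  have H: "closed ?H"
    by (intro closed_Collect_eq continuous_intros continuous_on_product_coordinates)
  have "?K = ?B \<inter> ?H"
  proof (intro equalityI subsetI)
    fix x assume x: "x \<in> ?K"
    have "x i \<le> 1" if "i \<in> A" for i
    proof -
      have "x i ^ k \<le> (\<Sum>i\<in>A. x i ^ k)"
        using x assms(1) that by (intro member_le_sum) auto
      then have "\<not> 1 < x i ^ k" using x by simp
      then show ?thesis using one_less_power[of "x i" k] assms(2) by fastforce
    qed
    then show "x \<in> ?B \<inter> ?H" using x by auto
  next
    fix x assume x: "x \<in> ?B \<inter> ?H"
    then have "x i \<in> (if i \<in> A then {0..1} else {0})" for i by (auto simp: PiE_def Pi_def)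
    then have "0 \<le> x i" "i \<notin> A \<Longrightarrow> x i = 0" for i
      by (metis atLeastAtMost_iff order_refl singletonD, metis singletonD)
    then show "x \<in> ?K" using x by blast
  qed
  then show ?thesis using compact_Int_closed[OF B H] by simp
qed

text \<open>Compactness gives a maximiser on the unit sphere; homogeneity of degree \<open>k\<close>
  then extends its maximality to all nonnegative vectors, which spares later perturbations from
  being normalised.\<close>

lemma alpha_form_maximiser:
  assumes E: "uniform_hypergraph k n E" and k: "k \<ge> 1"
  obtains u where "\<And>i. i \<in> {1..n} \<Longrightarrow> 0 \<le> u i" "(\<Sum>i\<in>{1..n}. u i ^ k) = 1"
    "\<And>x. (\<And>i. i \<in> {1..n} \<Longrightarrow> 0 \<le> x i) \<Longrightarrow>
       alpha_form \<alpha> k n E x \<le> alpha_form \<alpha> k n E u * (\<Sum>i\<in>{1..n}. x i ^ k)"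
proof -
  note ED = uniform_hypergraphD[OF E]
  let ?K = "{x :: nat \<Rightarrow> real. (\<forall>i\<in>{1..n}. 0 \<le> x i) \<and> (\<forall>i. i \<notin> {1..n} \<longrightarrow> x i = 0) \<and> (\<Sum>i\<in>{1..n}. x i ^ k) = 1}"
  have "compact ?K" using k by (intro compact_nonneg_power_sphere) auto
  moreover have "?K \<noteq> {}"
  proof -
    obtain e where e: "e \<in> E" using ED(1) by blast
    have "e \<noteq> {}" using ED(4)[OF e] k by auto
    then obtain j where j: "j \<in> {1..n}" using ED(3)[OF e] by blast
    define v :: "nat \<Rightarrow> real" where "v = (\<lambda>i. if i = j then 1 else 0)"
    have "v i ^ k = v i" for i using k by (simp add: v_def)
    then have "(\<Sum>i\<in>{1..n}. v i ^ k) = 1" using j by (simp add: v_def)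
    then have "v \<in> ?K" using j by (auto simp: v_def)
    then show ?thesis by blast
  qed
  moreover have "continuous_on ?K (alpha_form \<alpha> k n E)"
    unfolding alpha_form_def[abs_def]
    by (intro continuous_intros continuous_on_subset[OF continuous_on_product_coordinates]) auto
  ultimately obtain u where u: "u \<in> ?K"
    and max: "\<And>y. y \<in> ?K \<Longrightarrow> alpha_form \<alpha> k n E y \<le> alpha_form \<alpha> k n E u"
    using continuous_attains_sup[of ?K "alpha_form \<alpha> k n E"] by blast
  have "alpha_form \<alpha> k n E x \<le> alpha_form \<alpha> k n E u * (\<Sum>i\<in>{1..n}. x i ^ k)"
    if x: "\<And>i. i \<in> {1..n} \<Longrightarrow> 0 \<le> x i" for x
  proof -
    define N where "N = (\<Sum>i\<in>{1..n}. x i ^ k)"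
    define c where "c = root k N"
    have N0: "N \<ge> 0" unfolding N_def using x by (intro sum_nonneg) auto
    have c: "c ^ k = N" "c \<ge> 0" unfolding c_def using N0 k by auto
    show ?thesis
    proof (cases "N = 0")
      case True
      then have "x i ^ k = 0" if "i \<in> {1..n}" for i
        using that x unfolding N_def by (subst (asm) sum_nonneg_eq_0_iff) auto
      \<comment> \<open>Writing zero as \<open>0 * 1\<close> exhibits the zero vector as a multiple
        with factor 0, so the scaling rule applies.\<close>
      then have "x i = 0 * 1" if "i \<in> {1..n}" for i using that k by auto
      then have "alpha_form \<alpha> k n E x = alpha_form \<alpha> k n E (\<lambda>i. 0 * 1)"
        by (intro alpha_form_cong[OF E]) auto
      also have "\<dots> = 0" using alpha_form_scale[OF E, of \<alpha> 0 "\<lambda>_. 1"] k by (simp add: power_0_left)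
      finally show ?thesis using True N_def by simp
    next
      case False
      then have c_pos: "c > 0" using N0 k by (simp add: c_def)
      define y where "y = (\<lambda>i. if i \<in> {1..n} then x i / c else 0)"
      have "(\<Sum>i\<in>{1..n}. y i ^ k) = N / c ^ k"
        unfolding N_def y_def by (simp add: power_divide sum_divide_distrib)
      then have "y \<in> ?K" using False c c_pos x unfolding y_def by auto
      then have le: "alpha_form \<alpha> k n E y \<le> alpha_form \<alpha> k n E u" by (rule max)
      have "alpha_form \<alpha> k n E x = alpha_form \<alpha> k n E (\<lambda>i. c * y i)"
        using c_pos by (intro alpha_form_cong[OF E]) (auto simp: y_def)
      also have "\<dots> = N * alpha_form \<alpha> k n E y" by (simp add: alpha_form_scale[OF E] c)
      also have "\<dots> \<le> N * alpha_form \<alpha> k n E u" using le N0 by (rule mult_left_mono)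
      finally show ?thesis unfolding N_def by (simp add: mult.commute)
    qed
  qed
  then show thesis using that[of u] u by auto
qed

lemma alpha_form_maximiser_pos:
  assumes E: "uniform_hypergraph k n E" and conn: "connected_hypergraph n E" and k: "k \<ge> 1"
    and \<alpha>: "0 \<le> \<alpha>" "\<alpha> < 1"
    and u0: "\<And>i. i \<in> {1..n} \<Longrightarrow> 0 \<le> u i" and u1: "(\<Sum>i\<in>{1..n}. u i ^ k) = 1"
    and max: "\<And>x. (\<And>i. i \<in> {1..n} \<Longrightarrow> 0 \<le> x i) \<Longrightarrow>
       alpha_form \<alpha> k n E x \<le> alpha_form \<alpha> k n E u * (\<Sum>i\<in>{1..n}. x i ^ k)"
    and i: "i \<in> {1..n}"
  shows "0 < u i"
proof (rule ccontr)
  note ED = uniform_hypergraphD[OF E]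
  assume "\<not> 0 < u i"
  then have ui: "u i = 0" using u0[OF i] by simp
  define Z where "Z = {j \<in> {1..n}. u j = 0}"
  have "\<exists>j\<in>{1..n}. u j \<noteq> 0"
  proof (rule ccontr)
    assume "\<not> ?thesis"
    then have "(\<Sum>i\<in>{1..n}. u i ^ k) = 0" using k by (simp add: power_0_left)
    then show False using u1 by simp
  qed
  then obtain j where j: "j \<in> {1..n}" "j \<notin> Z" unfolding Z_def by auto
  obtain e a b where e: "e \<in> E" and a: "a \<in> e" "a \<in> Z" and b: "b \<in> e" "b \<notin> Z"
    by (rule connected_hypergraph_crossing_edge[OF conn i _ j]) (use i ui Z_def in auto)
  have fe: "finite e" "card e = k" "e \<subseteq> {1..n}" using ED e by auto
  \<comment> \<open>\<open>C\<close> is the coefficient of the gain along the crossing edge; it is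
    positive because \<open>u\<close> vanishes nowhere on \<open>e - Z\<close>.\<close>
  define C where "C = (1 - \<alpha>) * real k * (\<Prod>j\<in>e - Z. u j)"
  have C: "C > 0"
    unfolding C_def using \<alpha> k fe u0 by (intro mult_pos_pos prod_pos) (force simp: Z_def less_le)+
  define lam where "lam = alpha_form \<alpha> k n E u"
  have ineq: "C \<le> lam * real (card Z) * eps" if eps: "0 < eps" "eps \<le> 1" for eps
  proof -
    define x where "x = (\<lambda>j. if j \<in> Z then eps else u j)"
    have x0: "0 \<le> u j" "u j \<le> x j" if "j \<in> {1..n}" for j
      using that u0 eps by (auto simp: x_def Z_def)
    have "(\<Sum>i\<in>{1..n}. x i ^ k) = (\<Sum>i\<in>{1..n}. u i ^ k + (if i \<in> Z then eps ^ k else 0))"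
      using k by (intro sum.cong refl) (auto simp: x_def Z_def power_0_left)
    also have "\<dots> = 1 + real (card Z) * eps ^ k"
    proof -
      have "{1..n} \<inter> Z = Z" by (auto simp: Z_def)
      then show ?thesis using u1 by (simp add: sum.distrib flip: sum.inter_restrict)
    qed
    finally have sum_x: "(\<Sum>i\<in>{1..n}. x i ^ k) = 1 + real (card Z) * eps ^ k" .
    have other: "(\<Prod>i\<in>f. u i) \<le> (\<Prod>i\<in>f. x i)" if "f \<in> E" for f
      using ED(3)[OF that] x0 by (intro prod_mono) auto
    have this_edge: "(\<Prod>i\<in>e. u i) + (\<Prod>j\<in>e - Z. u j) * eps ^ (k - 1) \<le> (\<Prod>i\<in>e. x i)"
    proof -
      have "(\<Prod>i\<in>e. u i) = 0" using a fe by (auto simp: Z_def)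
      moreover have "(\<Prod>i\<in>e. x i) = (\<Prod>i\<in>e - Z. x i) * (\<Prod>i\<in>e \<inter> Z. x i)"
        using fe by (metis Diff_Diff_Int Diff_subset mult.commute prod.subset_diff)
      moreover have "(\<Prod>i\<in>e - Z. x i) = (\<Prod>j\<in>e - Z. u j)" by (auto simp: x_def)
      moreover have "(\<Prod>i\<in>e \<inter> Z. x i) = eps ^ card (e \<inter> Z)" by (simp add: x_def)
      \<comment> \<open>The vertex \<open>b\<close> lies outside \<open>Z\<close>, so at most
        \<open>k - 1\<close> vertices of \<open>e\<close> are raised to \<open>eps\<close>.\<close>
      moreover have "eps ^ (k - 1) \<le> eps ^ card (e \<inter> Z)"
      proof (rule power_decreasing)
        have "card (e \<inter> Z) < card e" using b fe by (intro psubset_card_mono) auto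
        then show "card (e \<inter> Z) \<le> k - 1" using fe by simp
      qed (use eps in auto)
      moreover have "(\<Prod>j\<in>e - Z. u j) \<ge> 0" using u0 fe by (intro prod_nonneg) auto
      ultimately show ?thesis by (simp add: mult_left_mono)
    qed
    have "(\<Sum>f\<in>E. \<Prod>i\<in>f. u i) + (\<Prod>j\<in>e - Z. u j) * eps ^ (k - 1) \<le> (\<Sum>f\<in>E. \<Prod>i\<in>f. x i)"
      using this_edge sum_mono[of "E - {e}" "\<lambda>f. \<Prod>i\<in>f. u i" "\<lambda>f. \<Prod>i\<in>f. x i"] other
      by (simp add: sum.remove[OF ED(2) e])
    then have "(1 - \<alpha>) * real k * ((\<Sum>f\<in>E. \<Prod>i\<in>f. u i) + (\<Prod>j\<in>e - Z. u j) * eps ^ (k - 1))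
        \<le> (1 - \<alpha>) * real k * (\<Sum>f\<in>E. \<Prod>i\<in>f. x i)"
      using \<alpha> by (intro mult_left_mono) auto
    moreover have "\<alpha> * (\<Sum>i\<in>{1..n}. real (vertex_degree E i) * u i ^ k)
        \<le> \<alpha> * (\<Sum>i\<in>{1..n}. real (vertex_degree E i) * x i ^ k)"
      using \<alpha> x0 by (intro mult_left_mono sum_mono power_mono) auto
    ultimately have "lam + C * eps ^ (k - 1) \<le> alpha_form \<alpha> k n E x"
      unfolding lam_def alpha_form_def C_def by (simp add: algebra_simps)
    also have "\<dots> \<le> lam * (1 + real (card Z) * eps ^ k)"
      using max[of x] x0 unfolding sum_x lam_def by force
    finally have "C * eps ^ (k - 1) \<le> (lam * real (card Z) * eps) * eps ^ (k - 1)"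
      using k by (cases k) (auto simp: algebra_simps)
    then show ?thesis using eps by simp
  qed
  \<comment> \<open>The choice below makes \<open>B * eps\<close> at most \<open>C / 2\<close>,
    contradicting \<open>ineq\<close>.\<close>
  define B where "B = lam * real (card Z)"
  have B: "B > 0" using ineq[of 1] C by (simp add: B_def)
  define eps where "eps = min 1 (C / (2 * B))"
  have "B * eps \<le> B * (C / (2 * B))" unfolding eps_def using B by (intro mult_left_mono) auto
  also have "\<dots> = C / 2" using B by simp
  finally show False using ineq[of eps] C B unfolding eps_def B_def[symmetric] by auto
qed

text \<open>Subtracting \<open>lam\<close> times the power sum takes the place of a Lagrange
  multiplier: with all other entries frozen, \<open>phi\<close> is at most 0 for nonnegative
  arguments and equals 0 at \<open>u i\<close>. Its derivative there is \<open>k\<close> times the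
  difference of the two sides of the eigenvalue equation.\<close>

lemma alpha_form_maximiser_stationary:
  assumes E: "uniform_hypergraph k n E" and k: "k \<ge> 1"
    and u0: "\<And>i. i \<in> {1..n} \<Longrightarrow> 0 < u i" and u1: "(\<Sum>i\<in>{1..n}. u i ^ k) = 1"
    and max: "\<And>x. (\<And>i. i \<in> {1..n} \<Longrightarrow> 0 \<le> x i) \<Longrightarrow>
       alpha_form \<alpha> k n E x \<le> alpha_form \<alpha> k n E u * (\<Sum>i\<in>{1..n}. x i ^ k)"
    and i: "i \<in> {1..n}"
  shows "\<alpha> * real (vertex_degree E i) * u i ^ (k - 1)
      + (1 - \<alpha>) * (\<Sum>e | e \<in> E \<and> i \<in> e. \<Prod>j\<in>e - {i}. u j) = alpha_form \<alpha> k n E u * u i ^ (k - 1)"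
proof -
  note ED = uniform_hypergraphD[OF E]
  define lam where "lam = alpha_form \<alpha> k n E u"
  define P where "P = (\<Sum>e | e \<in> E \<and> i \<in> e. \<Prod>j\<in>e - {i}. u j)"
  define phi where "phi = (\<lambda>t. alpha_form \<alpha> k n E (u(i := t)) - lam * (\<Sum>j\<in>{1..n}. (u(i := t)) j ^ k))"
  define A where "A = \<alpha> * (\<Sum>j\<in>{1..n} - {i}. real (vertex_degree E j) * u j ^ k)
    + (1 - \<alpha>) * real k * (\<Sum>e | e \<in> E \<and> i \<notin> e. \<Prod>j\<in>e. u j) - lam * (\<Sum>j\<in>{1..n} - {i}. u j ^ k)"
  have split: "(\<Sum>j\<in>{1..n}. f j * (u(i := t)) j ^ k) = f i * t ^ k + (\<Sum>j\<in>{1..n} - {i}. f j * u j ^ k)"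
    for f :: "nat \<Rightarrow> real" and t
    by (subst sum.remove[of _ i]) (use i in auto)
  have edges: "(\<Sum>e\<in>E. \<Prod>j\<in>e. (u(i := t)) j) = t * P + (\<Sum>e | e \<in> E \<and> i \<notin> e. \<Prod>j\<in>e. u j)" for t
  proof -
    have "(\<Sum>e\<in>E. \<Prod>j\<in>e. (u(i := t)) j) =
        (\<Sum>e | e \<in> E \<and> i \<in> e. \<Prod>j\<in>e. (u(i := t)) j) + (\<Sum>e | e \<in> E \<and> i \<notin> e. \<Prod>j\<in>e. (u(i := t)) j)"
      using ED(2) by (subst sum.union_disjoint[symmetric]) (auto intro!: sum.cong)
    also have "(\<Sum>e | e \<in> E \<and> i \<in> e. \<Prod>j\<in>e. (u(i := t)) j) = t * P"
      unfolding P_def sum_distrib_left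
    proof (rule sum.cong[OF refl])
      fix e assume "e \<in> {e \<in> E. i \<in> e}"
      then show "(\<Prod>j\<in>e. (u(i := t)) j) = t * (\<Prod>j\<in>e - {i}. u j)"
        using ED(5)[of e] by (subst prod.remove[of _ i]) auto
    qed
    also have "(\<Sum>e | e \<in> E \<and> i \<notin> e. \<Prod>j\<in>e. (u(i := t)) j) = (\<Sum>e | e \<in> E \<and> i \<notin> e. \<Prod>j\<in>e. u j)"
      by (intro sum.cong prod.cong refl) auto
    finally show ?thesis .
  qed
  have phi: "phi t = A + (1 - \<alpha>) * real k * P * t + (\<alpha> * real (vertex_degree E i) - lam) * t ^ k" for t
    unfolding phi_def alpha_form_def A_def edges split using split[of "\<lambda>_. 1" t]
    by (simp add: algebra_simps)
  have "DERIV phi (u i) :> (1 - \<alpha>) * real k * P + (\<alpha> * real (vertex_degree E i) - lam) * (real k * u i ^ (k - 1))"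
    unfolding phi[abs_def] by (auto intro!: derivative_eq_intros)
  then have "(1 - \<alpha>) * real k * P + (\<alpha> * real (vertex_degree E i) - lam) * (real k * u i ^ (k - 1)) = 0"
  proof (rule DERIV_local_max[OF _ u0[OF i]], intro allI impI)
    \<comment> \<open>The radius \<open>u i\<close> keeps \<open>t\<close> positive, so the changed
      vector stays where \<open>max\<close> applies; this is where positivity of \<open>u\<close> is
      essential.\<close>
    fix t assume "\<bar>u i - t\<bar> < u i"
    then have "\<And>j. j \<in> {1..n} \<Longrightarrow> 0 \<le> (u(i := t)) j" using u0 by (auto intro: less_imp_le)
    then have "alpha_form \<alpha> k n E (u(i := t)) \<le> lam * (\<Sum>j\<in>{1..n}. (u(i := t)) j ^ k)"
      unfolding lam_def by (rule max)
    then have "phi t \<le> 0" unfolding phi_def by simp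
    also have "0 = phi (u i)" unfolding phi_def using u1 by (simp add: lam_def)
    finally show "phi t \<le> phi (u i)" .
  qed
  then have "real k * ((1 - \<alpha>) * P + (\<alpha> * real (vertex_degree E i) - lam) * u i ^ (k - 1)) = 0"
    by (simp add: algebra_simps)
  then have "(1 - \<alpha>) * P + (\<alpha> * real (vertex_degree E i) - lam) * u i ^ (k - 1) = 0"
    using k by simp
  then show ?thesis unfolding P_def lam_def by (simp add: algebra_simps)
qed

lemma positive_eigenvector_exists:
  assumes "uniform_hypergraph k n E" "connected_hypergraph n E" "k \<ge> 1" "0 \<le> \<alpha>" "\<alpha> < 1"
  obtains u c where "\<And>i. i \<in> {1..n} \<Longrightarrow> 0 < (u i :: real)"
    "\<And>i. i \<in> {1..n} \<Longrightarrow> \<alpha> * real (vertex_degree E i) * u i ^ (k - 1)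
      + (1 - \<alpha>) * (\<Sum>e | e \<in> E \<and> i \<in> e. \<Prod>j\<in>e - {i}. u j) = c * u i ^ (k - 1)"
proof -
  obtain u where u: "\<And>i. i \<in> {1..n} \<Longrightarrow> 0 \<le> u i" "(\<Sum>i\<in>{1..n}. u i ^ k) = 1"
    "\<And>x. (\<And>i. i \<in> {1..n} \<Longrightarrow> 0 \<le> x i) \<Longrightarrow>
       alpha_form \<alpha> k n E x \<le> alpha_form \<alpha> k n E u * (\<Sum>i\<in>{1..n}. x i ^ k)"
    by (rule alpha_form_maximiser[OF assms(1,3)]) blast
  have pos: "0 < u i" if "i \<in> {1..n}" for i
    using alpha_form_maximiser_pos[OF assms u that] .
  show thesis
    using that[OF pos alpha_form_maximiser_stationary[OF assms(1,3) pos u(2,3)]] .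
qed

section \<open>Lower bound for the eigenvalue of a positive eigenvector\<close>

lemma edge_arith_geom_mean:
  fixes u :: "'a \<Rightarrow> real"
  assumes e: "finite e" "i \<in> e" and u: "\<And>j. j \<in> e \<Longrightarrow> 0 < u j" and a: "a \<ge> 0"
  shows "real (card e) * a \<le> (\<Prod>j\<in>e. u j) * (a ^ card e / u i ^ card e + (\<Sum>j\<in>e - {i}. 1 / u j ^ card e))"
proof -
  define k where "k = card e"
  have k: "k > 0" using e by (auto simp: k_def card_gt_0_iff)
  \<comment> \<open>The \<open>z j\<close> are the \<open>k\<close>-th roots of the numbers to be
    averaged, so their geometric mean is the plain product of the \<open>z j\<close>.\<close>
  define z where "z = (\<lambda>j. (if j = i then a else 1) / u j)"
  have U: "(\<Prod>j\<in>e. u j) > 0" using u by (intro prod_pos) auto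
  have z0: "z j \<ge> 0" if "j \<in> e" for j using that a u[OF that] by (auto simp: z_def)
  have "(\<Prod>j\<in>e. z j) = a / (\<Prod>j\<in>e. u j)"
    unfolding z_def prod_dividef using e by (simp add: prod.delta)
  moreover have "(\<Prod>j\<in>e. z j ^ k) powr (1 / real k) = (\<Prod>j\<in>e. z j)"
  proof -
    have "(\<Prod>j\<in>e. z j) \<ge> 0" using z0 by (rule prod_nonneg)
    then show ?thesis using k
      by (simp add: powr_inverse_root real_root_power_cancel flip: prod_power_distrib)
  qed
  ultimately have "a / (\<Prod>j\<in>e. u j) \<le> (\<Sum>j\<in>e. z j ^ k / real k)"
    using arith_geom_mean[of e "\<lambda>j. z j ^ k"] e z0 by (force simp: k_def)
  also have "\<dots> = (\<Sum>j\<in>e. z j ^ k) / real k" by (simp add: sum_divide_distrib)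
  also have "(\<Sum>j\<in>e. z j ^ k) = a ^ k / u i ^ k + (\<Sum>j\<in>e - {i}. 1 / u j ^ k)"
    using e by (subst sum.remove[of _ i]) (auto simp: z_def power_divide)
  finally show ?thesis using U k by (simp add: field_simps flip: k_def)
qed

text \<open>This bounds the multilinear form of the tensor at \<open>(x, 1, \<dots>, 1)\<close> through a positive
  eigenvector, which is sharper than evaluating the homogeneous form at \<open>x\<close>.\<close>
lemma alpha_eigenvalue_lower_bound:
  fixes u x :: "nat \<Rightarrow> real"
  assumes E: "uniform_hypergraph k n E" and k: "k \<ge> 1" and \<alpha>: "\<alpha> \<le> 1"
    and u: "\<And>i. i \<in> {1..n} \<Longrightarrow> 0 < u i"
    and eq: "\<And>i. i \<in> {1..n} \<Longrightarrow> \<alpha> * real (vertex_degree E i) * u i ^ (k - 1)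
      + (1 - \<alpha>) * (\<Sum>e | e \<in> E \<and> i \<in> e. \<Prod>j\<in>e - {i}. u j) = c * u i ^ (k - 1)"
    and x: "\<And>i. i \<in> {1..n} \<Longrightarrow> 0 \<le> x i"
  shows "\<alpha> * (\<Sum>i\<in>{1..n}. real (vertex_degree E i) * (x i ^ k + (real k - 1)))
      + (1 - \<alpha>) * real k * (\<Sum>i\<in>{1..n}. real (vertex_degree E i) * x i)
    \<le> c * ((\<Sum>i\<in>{1..n}. x i ^ k) + (real k - 1) * real n)"
proof -
  note ED = uniform_hypergraphD[OF E]
  \<comment> \<open>The multiplier of the \<open>i\<close>-th equation. After division by
    \<open>u i ^ (k - 1)\<close>, each edge carries the common weight
    \<open>\<Prod>j\<in>e. u j\<close>, the same for all its vertices.\<close>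
  define w where "w = (\<lambda>i. x i ^ k + (real k - 1))"
  have c: "c * w i = \<alpha> * (real (vertex_degree E i) * w i)
      + (1 - \<alpha>) * (\<Sum>e | e \<in> E \<and> i \<in> e. (\<Prod>j\<in>e. u j) * (w i / u i ^ k))" if i: "i \<in> {1..n}" for i
  proof -
    have ui: "u i > 0" using u[OF i] .
    have uk: "u i ^ k = u i * u i ^ (k - 1)" using k by (cases k) auto
    have "(\<Sum>e | e \<in> E \<and> i \<in> e. (\<Prod>j\<in>e. u j) * (w i / u i ^ k))
       = (\<Sum>e | e \<in> E \<and> i \<in> e. (\<Prod>j\<in>e - {i}. u j)) * (w i / u i ^ (k - 1))"
      unfolding sum_distrib_right
    proof (rule sum.cong[OF refl])
      fix e assume "e \<in> {e \<in> E. i \<in> e}"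
      then have "(\<Prod>j\<in>e. u j) = u i * (\<Prod>j\<in>e - {i}. u j)"
        using ED(5)[of e] by (subst prod.remove[of _ i]) auto
      then show "(\<Prod>j\<in>e. u j) * (w i / u i ^ k) = (\<Prod>j\<in>e - {i}. u j) * (w i / u i ^ (k - 1))"
        using ui by (simp add: uk)
    qed
    then have "\<alpha> * (real (vertex_degree E i) * w i)
      + (1 - \<alpha>) * (\<Sum>e | e \<in> E \<and> i \<in> e. (\<Prod>j\<in>e. u j) * (w i / u i ^ k))
      = (\<alpha> * real (vertex_degree E i) * u i ^ (k - 1)
      + (1 - \<alpha>) * (\<Sum>e | e \<in> E \<and> i \<in> e. \<Prod>j\<in>e - {i}. u j)) * (w i / u i ^ (k - 1))"
      using ui by (simp add: field_simps)
    also have "\<dots> = c * w i" unfolding eq[OF i] using ui by simp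
    finally show ?thesis ..
  qed
  have edge: "(\<Sum>i\<in>e. real k * x i) \<le> (\<Sum>i\<in>e. (\<Prod>j\<in>e. u j) * (w i / u i ^ k))" if e: "e \<in> E" for e
  proof -
    have fe: "finite e" "card e = k" "e \<subseteq> {1..n}" using ED e by auto
    let ?T = "\<Sum>j\<in>e. 1 / u j ^ k"
    have "(\<Sum>i\<in>e. real k * x i) \<le>
        (\<Sum>i\<in>e. (\<Prod>j\<in>e. u j) * (x i ^ k / u i ^ k + (\<Sum>j\<in>e - {i}. 1 / u j ^ k)))"
      using edge_arith_geom_mean[of e _ u] fe u x by (intro sum_mono) (auto simp: subset_iff)
    also have "\<dots> = (\<Prod>j\<in>e. u j) * (\<Sum>i\<in>e. x i ^ k / u i ^ k + (?T - 1 / u i ^ k))"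
      using fe by (simp add: sum_distrib_left sum_diff1)
    \<comment> \<open>Each \<open>1 / u j ^ k\<close> occurs for the \<open>k - 1\<close> choices of
      \<open>i\<close> other than \<open>j\<close>; this is the source of the summand
      \<open>real k - 1\<close> in \<open>w\<close>.\<close>
    also have "(\<Sum>i\<in>e. x i ^ k / u i ^ k + (?T - 1 / u i ^ k))
        = (\<Sum>i\<in>e. x i ^ k / u i ^ k) + real k * ?T - ?T"
      using fe by (simp add: sum.distrib sum_subtractf)
    also have "\<dots> = (\<Sum>i\<in>e. w i / u i ^ k)"
      by (simp add: w_def add_divide_distrib diff_divide_distrib sum.distrib sum_subtractf sum_distrib_left)
    finally show ?thesis by (simp add: sum_distrib_left)
  qed
  have "real k * (\<Sum>i\<in>{1..n}. real (vertex_degree E i) * x i) = (\<Sum>e\<in>E. \<Sum>i\<in>e. real k * x i)"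
    unfolding sum_edges_vertex[OF E] sum_distrib_left by (simp add: mult_ac)
  also have "\<dots> \<le> (\<Sum>e\<in>E. \<Sum>i\<in>e. (\<Prod>j\<in>e. u j) * (w i / u i ^ k))"
    using edge by (rule sum_mono)
  also have "\<dots> = (\<Sum>i\<in>{1..n}. \<Sum>e | e \<in> E \<and> i \<in> e. (\<Prod>j\<in>e. u j) * (w i / u i ^ k))"
    by (rule sum_edges_swap[OF E])
  finally have "(1 - \<alpha>) * (real k * (\<Sum>i\<in>{1..n}. real (vertex_degree E i) * x i))
      \<le> (1 - \<alpha>) * (\<Sum>i\<in>{1..n}. \<Sum>e | e \<in> E \<and> i \<in> e. (\<Prod>j\<in>e. u j) * (w i / u i ^ k))"
    using \<alpha> by (intro mult_left_mono) auto
  moreover have "(\<Sum>i\<in>{1..n}. c * w i) = \<alpha> * (\<Sum>i\<in>{1..n}. real (vertex_degree E i) * w i)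
      + (1 - \<alpha>) * (\<Sum>i\<in>{1..n}. \<Sum>e | e \<in> E \<and> i \<in> e. (\<Prod>j\<in>e. u j) * (w i / u i ^ k))"
    by (simp add: c sum.distrib sum_distrib_left)
  moreover have "(\<Sum>i\<in>{1..n}. c * w i) = c * ((\<Sum>i\<in>{1..n}. x i ^ k) + (real k - 1) * real n)"
    by (simp add: w_def sum.distrib mult.commute[of "real n"] flip: sum_distrib_left)
  ultimately show ?thesis unfolding w_def by (simp add: mult.assoc)
qed

text \<open>The normalisation of \<open>x\<close> makes the multipliers
  \<open>x i ^ k + (real k - 1)\<close> add up to \<open>real k * real n\<close>. Regrouping the
  linear terms isolates a bracket that vanishes wherever \<open>x i\<close> is 1.\<close>

lemma rho_alpha_lower_bound:
  fixes x :: "nat \<Rightarrow> real"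
  assumes E: "uniform_hypergraph k n E" "connected_hypergraph n E" and k: "k \<ge> 1"
    and \<alpha>: "0 \<le> \<alpha>" "\<alpha> < 1"
    and x: "\<And>i. i \<in> {1..n} \<Longrightarrow> 0 \<le> x i" "(\<Sum>i\<in>{1..n}. x i ^ k) = real n"
  shows "\<alpha> * (\<Sum>i\<in>{1..n}. real (vertex_degree E i) * (x i ^ k + (real k - 1) - real k * x i))
      + real k * (\<Sum>i\<in>{1..n}. real (vertex_degree E i) * x i) \<le> rho_alpha \<alpha> k n E * (real k * real n)"
proof -
  obtain u c where u: "\<And>i. i \<in> {1..n} \<Longrightarrow> 0 < (u i :: real)"
    and eq: "\<And>i. i \<in> {1..n} \<Longrightarrow> \<alpha> * real (vertex_degree E i) * u i ^ (k - 1)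
      + (1 - \<alpha>) * (\<Sum>e | e \<in> E \<and> i \<in> e. \<Prod>j\<in>e - {i}. u j) = c * u i ^ (k - 1)"
    by (rule positive_eigenvector_exists[OF E k \<alpha>]) blast
  obtain e where e: "e \<in> E" using uniform_hypergraphD(1)[OF E(1)] by blast
  then have "e \<noteq> {}" using uniform_hypergraphD(4)[OF E(1)] k by fastforce
  then obtain j where j: "j \<in> {1..n}" using uniform_hypergraphD(3)[OF E(1) e] by blast
  have "u j \<noteq> 0" using u[OF j] by simp
  then have c: "c \<le> rho_alpha \<alpha> k n E" using le_rho_alphaI[OF E(1) k j _ eq] by blast
  have "\<alpha> * (\<Sum>i\<in>{1..n}. real (vertex_degree E i) * (x i ^ k + (real k - 1) - real k * x i))
      + real k * (\<Sum>i\<in>{1..n}. real (vertex_degree E i) * x i)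
    = \<alpha> * (\<Sum>i\<in>{1..n}. real (vertex_degree E i) * (x i ^ k + (real k - 1)))
      + (1 - \<alpha>) * real k * (\<Sum>i\<in>{1..n}. real (vertex_degree E i) * x i)"
    by (simp add: algebra_simps sum.distrib sum_subtractf sum_distrib_left)
  also have "\<dots> \<le> c * ((\<Sum>i\<in>{1..n}. x i ^ k) + (real k - 1) * real n)"
    using \<alpha> by (intro alpha_eigenvalue_lower_bound[OF E(1) k _ u eq x(1)]) auto
  also have "\<dots> = c * (real k * real n)" unfolding x(2) by (simp add: algebra_simps)
  also have "\<dots> \<le> rho_alpha \<alpha> k n E * (real k * real n)"
    using c by (intro mult_right_mono) auto
  finally show ?thesis .
qed

section \<open>The explicit test vector and the final estimate\<close>

text \<open>With t the square root of \<open>y\<close>, the claim reads k t^(2/k) <= 2 t + k - 2.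
  This is weighted AM-GM for t and 1 with weights 2/k and 1 - 2/k, the second being nonnegative
  since \<open>k\<close> is at least 2.\<close>

lemma sqrt_deviation_le:
  fixes y k :: real
  assumes y: "0 \<le> y" and k: "k \<ge> 2"
  shows "(y powr (1 / 2) - 1)\<^sup>2 \<le> y + (k - 1) - k * y powr (1 / k)"
proof (cases "y = 0")
  case False
  then have y: "y > 0" using y by simp
  define t where "t = y powr (1 / 2)"
  have t: "t > 0" "t\<^sup>2 = y" using y by (auto simp: t_def powr_half_sqrt)
  have "t powr (2 / k) * 1 powr (1 - 2 / k) \<le> 2 / k * t + (1 - 2 / k) * 1"
    using k t by (intro Youngs_inequality_0) (auto simp: field_simps)
  moreover have "t powr (2 / k) = y powr (1 / k)" unfolding t_def by (simp add: powr_powr)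
  ultimately have "k * y powr (1 / k) \<le> k * (2 / k * t + (1 - 2 / k))"
    using k by (intro mult_left_mono) auto
  also have "\<dots> = 2 * t + (k - 2)" using k by (simp add: field_simps)
  finally show ?thesis using t by (simp add: power2_diff flip: t_def)
\<comment> \<open>At \<open>y = 0\<close> both powers are 0 and the claim is 1 <= k - 1.\<close>
qed (use k in auto)

text \<open>An edge with at least two vertices supplies a vertex other than \<open>i\<close>, so
  some edge leaves \<open>{i}\<close>. Positive degrees allow division by the sum \<open>D\<close>
  in the theorem.\<close>

lemma connected_hypergraph_degree_pos:
  assumes E: "uniform_hypergraph k n E" "connected_hypergraph n E" and k: "k \<ge> 2" and i: "i \<in> {1..n}"
  shows "vertex_degree E i > 0"
proof -
  note ED = uniform_hypergraphD[OF E(1)]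
  obtain e where e: "e \<in> E" using ED(1) by blast
  have "\<not> e \<subseteq> {i}" using ED(4)[OF e] k card_mono[of "{i}" e] by auto
  then obtain v where v: "v \<in> {1..n}" "v \<notin> {i}" using ED(3)[OF e] by blast
  obtain f a b where "f \<in> E" "a \<in> f" "a \<in> {i}" "b \<in> f" "b \<notin> {i}"
    by (rule connected_hypergraph_crossing_edge[OF E(2) i _ v]) auto
  then have "{e \<in> E. i \<in> e} \<noteq> {}" by auto
  then show ?thesis unfolding vertex_degree_def using ED(2) by (simp add: card_gt_0_iff)
qed

theorem theorem4p15:
  fixes k n m s :: nat and \<alpha> :: real and E :: "nat set set" and S :: "nat set" and d :: "nat \<Rightarrow> real"
  assumes "k \<ge> 3" and "0 \<le> \<alpha>" and "\<alpha> < 1"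
    and "uniform_hypergraph k n E" and "connected_hypergraph n E" and "m = card E"
    and "S \<subseteq> {1..n}" and "S \<noteq> {}" and "s = card S"
    and "\<And>i. d i = real (vertex_degree E i)"
  shows "rho_alpha \<alpha> k n E - real k * real m / real n \<ge>
    1 / (real k * real n) *
      (\<alpha> * (\<Sum>i\<in>S. d i *
          ((real s * d i powr (real k / (real k - 1))
             / (\<Sum>j\<in>S. d j powr (real k / (real k - 1)))) powr (1 / 2) - 1)\<^sup>2)
       + real k *
          (real s powr (1 / real k)
             * (\<Sum>i\<in>S. d i powr (real k / (real k - 1))) powr ((real k - 1) / real k)
           - (\<Sum>i\<in>S. d i)))"
proof -
  note k = assms(1) and E = assms(4,5) and d = assms(10)
  have fS: "finite S" using assms(7) by (rule finite_subset) simp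
  have n: "n > 0" using assms(7,8) by fastforce
  define p where "p = real k / (real k - 1)"
  define D where "D = (\<Sum>i\<in>S. d i powr p)"
  \<comment> \<open>Scaled to have mean 1 over \<open>S\<close>, so that replacing the value 1 by
    \<open>y\<close> on \<open>S\<close> keeps the total of \<open>x i ^ k\<close> at
    \<open>n\<close>.\<close>
  define y where "y = (\<lambda>i. real s * d i powr p / D)"
  define x where "x = (\<lambda>i. if i \<in> S then y i powr (1 / real k) else 1)"
  have d_pos: "d i > 0" if "i \<in> S" for i
    using connected_hypergraph_degree_pos[OF E, of i] that assms(7) k unfolding d by auto
  have s: "real s > 0" using assms(8,9) fS by (simp add: card_gt_0_iff)
  have D: "D > 0" unfolding D_def using fS assms(8) by (intro sum_pos) (auto dest: d_pos)
  have y: "y i > 0" if "i \<in> S" for i using d_pos[OF that] s D by (simp add: y_def)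
  have xk: "x i ^ k = (if i \<in> S then y i else 1)" for i
    using y[of i] k by (auto simp: x_def powr_powr simp flip: powr_realpow)
  have split: "(\<Sum>i\<in>{1..n}. g i) = (\<Sum>i\<in>S. g i) + (\<Sum>i\<in>{1..n} - S. g i)" for g :: "nat \<Rightarrow> real"
    using sum.subset_diff[OF assms(7), of g] by simp
  have "(\<Sum>i\<in>S. y i) = real s"
    unfolding y_def using D by (simp add: D_def flip: sum_divide_distrib sum_distrib_left)
  then have sum_xk: "(\<Sum>i\<in>{1..n}. x i ^ k) = real n"
    using card_Diff_subset[OF fS assms(7)] card_mono[OF _ assms(7)] assms(9)
    unfolding split xk by (simp add: of_nat_diff)
  have "(\<Sum>i\<in>S. d i * ((real s * d i powr p / D) powr (1 / 2) - 1)\<^sup>2)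
      \<le> (\<Sum>i\<in>S. d i * (x i ^ k + (real k - 1) - real k * x i))"
  proof (intro sum_mono mult_left_mono)
    fix i assume i: "i \<in> S"
    show "((real s * d i powr p / D) powr (1 / 2) - 1)\<^sup>2 \<le> x i ^ k + (real k - 1) - real k * x i"
      using sqrt_deviation_le[of "y i" "real k"] y[OF i] k i unfolding xk by (simp add: x_def y_def)
  qed (use d_pos in \<open>auto intro: less_imp_le\<close>)
  \<comment> \<open>Off \<open>S\<close> the bracket is 1 + (k - 1) - k = 0.\<close>
  also have "\<dots> = (\<Sum>i\<in>{1..n}. d i * (x i ^ k + (real k - 1) - real k * x i))"
    unfolding split by (simp add: x_def)
  finally have quad: "\<alpha> * (\<Sum>i\<in>S. d i * ((real s * d i powr p / D) powr (1 / 2) - 1)\<^sup>2)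
      \<le> \<alpha> * (\<Sum>i\<in>{1..n}. d i * (x i ^ k + (real k - 1) - real k * x i))"
    using assms(2) by (rule mult_left_mono)
  have "(\<Sum>i\<in>S. d i * x i) = (\<Sum>i\<in>S. real s powr (1 / real k) * d i powr p / D powr (1 / real k))"
  proof (rule sum.cong[OF refl])
    fix i assume i: "i \<in> S"
    have "d i * (d i powr p) powr (1 / real k) = d i powr (1 + p * (1 / real k))"
      using d_pos[OF i] by (simp add: powr_add powr_powr)
    \<comment> \<open>\<open>p\<close> is the exponent conjugate to \<open>k\<close>, so each
      \<open>d i * x i\<close> is a multiple of \<open>d i powr p\<close> and the sum collapses to a
      power of \<open>D\<close>: the equality case of Hoelder's inequality.\<close>
    also have "1 + p * (1 / real k) = p" using k by (simp add: p_def field_simps)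
    finally show "d i * x i = real s powr (1 / real k) * d i powr p / D powr (1 / real k)"
      using i s D by (simp add: x_def y_def powr_mult powr_divide mult_ac)
  qed
  also have "\<dots> = real s powr (1 / real k) * (D powr 1 / D powr (1 / real k))"
    using D by (simp add: D_def flip: sum_divide_distrib sum_distrib_left)
  also have "D powr 1 / D powr (1 / real k) = D powr ((real k - 1) / real k)"
    using k by (simp only: powr_diff[symmetric]) (simp add: diff_divide_distrib)
  finally have lin_S: "(\<Sum>i\<in>S. d i * x i) = real s powr (1 / real k) * D powr ((real k - 1) / real k)" .
  have "(\<Sum>i\<in>{1..n}. d i) = real k * real m"
    using sum_vertex_degree[OF E(1)] assms(6) by (simp add: d)
  \<comment> \<open>Off \<open>S\<close> the terms are plain degrees, that is, the total degree
    \<open>real k * real m\<close> less the degrees in \<open>S\<close>.\<close>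
  then have lin: "(\<Sum>i\<in>{1..n}. d i * x i) = real k * real m
      + (real s powr (1 / real k) * D powr ((real k - 1) / real k) - (\<Sum>i\<in>S. d i))"
    unfolding split lin_S by (simp add: x_def)
  have "\<alpha> * (\<Sum>i\<in>{1..n}. d i * (x i ^ k + (real k - 1) - real k * x i))
      + real k * (\<Sum>i\<in>{1..n}. d i * x i) \<le> rho_alpha \<alpha> k n E * (real k * real n)"
    using rho_alpha_lower_bound[OF E _ assms(2,3) _ sum_xk] k unfolding d by (simp add: x_def)
  then have "\<alpha> * (\<Sum>i\<in>S. d i * ((real s * d i powr p / D) powr (1 / 2) - 1)\<^sup>2)
      + real k * (real s powr (1 / real k) * D powr ((real k - 1) / real k) - (\<Sum>i\<in>S. d i))
      \<le> rho_alpha \<alpha> k n E * (real k * real n) - real k * (real k * real m)"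
    using quad unfolding lin by (simp add: algebra_simps)
  also have "\<dots> = (rho_alpha \<alpha> k n E - real k * real m / real n) * (real k * real n)"
    using n by (simp add: field_simps)
  finally show ?thesis
    using n k unfolding D_def p_def by (simp add: divide_le_eq)
qed

end
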